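(* Let $p,q,r,s$ be real numbers with $p\ge 0$, and let $D_n$ be the $n\times n$ symmetric pentadiagonal matrix with perturbed corners determined by $p,q,r,s$. Consider the following sets of triples $(p,q,s)$: $$\mathcal D_1=\left\{-\tfrac p2\le s<0,\ -\tfrac12(p+2s)\le q\le \tfrac12(p+2s)\right\},$$ $$\mathcal D_2=\left\{s=0,\ p\ge 2|q|\right\},$$ $$\mathcal D_3=\left\{0<s\le \tfrac p2,\ -\sqrt{4s(p-2s)}\le q\le \sqrt{4s(p-2s)}\right\},$$ $$\mathcal D_4=\left\{0<s<\tfrac p6,\ \left(-\tfrac12(p+2s)\le q<-\sqrt{4s(p-2s)}\ \text{ or }\ \sqrt{4s(p-2s)}<q\le \tfrac12(p+2s)\right)\right\}.$$ If $r\ge p-s$ and $(p,q,s)\in \mathcal D_1\cup\mathcal D_2\cup\mathcal D_3\cup\mathcal D_4$, then $D_n$ is non-negative definite for all $n\in\mathbb N$.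
   Context: For real $p,q,r,s$, $D_n=[d_{ij}]_{1\le i,j\le n}$ is the real symmetric $n\times n$ matrix with $d_{11}=d_{nn}=r$, $d_{ii}=p$ for $2\le i\le n-1$, $d_{ij}=q$ if $|i-j|=1$, $d_{ij}=s$ if $|i-j|=2$, and $d_{ij}=0$ if $|i-j|\ge 3$. A real symmetric matrix $M$ is non-negative definite if $x^TMx\ge 0$ for every non-zero real column vector $x$ (equivalently, all its eigenvalues are non-negative). *)

theory Defs
  imports Complex_Main "Jordan_Normal_Form.Matrix"
begin

(* Rows and columns of matrices are indexed from 0, so the corner positions are
   0 and n - 1.  The corner test comes before the p case, so that for n = 1 the only
   entry is r. *)
definition penta_mat :: "real \<Rightarrow> real \<Rightarrow> real \<Rightarrow> real \<Rightarrow> nat \<Rightarrow> real mat" where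
  "penta_mat p q r s n = mat n n (\<lambda>(i, j).
     if i = j then (if i = 0 \<or> i = n - 1 then r else p)
     else if \<bar>int i - int j\<bar> = 1 then q
     else if \<bar>int i - int j\<bar> = 2 then s
     else 0)"

definition nonneg_definite :: "real mat \<Rightarrow> bool" where
  "nonneg_definite M \<longleftrightarrow>
     square_mat M \<and> transpose_mat M = M \<and>
     (\<forall>x \<in> carrier_vec (dim_row M). x \<noteq> 0\<^sub>v (dim_row M) \<longrightarrow> 0 \<le> x \<bullet> (M *\<^sub>v x))"

(* The elements of the following sets are the triples (p, q, s). *)

definition D1 :: "(real \<times> real \<times> real) set" where
  "D1 = {(p, q, s). - p / 2 \<le> s \<and> s < 0 \<and>
           - (1/2) * (p + 2 * s) \<le> q \<and> q \<le> (1/2) * (p + 2 * s)}"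

definition D2 :: "(real \<times> real \<times> real) set" where
  "D2 = {(p, q, s). s = 0 \<and> p \<ge> 2 * \<bar>q\<bar>}"

definition D3 :: "(real \<times> real \<times> real) set" where
  "D3 = {(p, q, s). 0 < s \<and> s \<le> p / 2 \<and>
           - sqrt (4 * s * (p - 2 * s)) \<le> q \<and> q \<le> sqrt (4 * s * (p - 2 * s))}"

definition D4 :: "(real \<times> real \<times> real) set" where
  "D4 = {(p, q, s). 0 < s \<and> s < p / 6 \<and>
           (- (1/2) * (p + 2 * s) \<le> q \<and> q < - sqrt (4 * s * (p - 2 * s)) \<or>
            sqrt (4 * s * (p - 2 * s)) < q \<and> q \<le> (1/2) * (p + 2 * s))}"

end

theory Submission
  imports Defs
begin

text \<open>
  Let \<open>T\<close> be the \<open>n \<times> n\<close> matrix with ones next to the diagonal and zeros elsewhere. For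
  \<open>n \<ge> 2\<close> the square of \<open>T\<close> has ones at distance two from the diagonal, and on the diagonal
  it has twos, except for ones in the two corners. Hence
  \<open>D = s T\<^sup>2 + q T + (p - 2 s) I + (r - (p - s)) E\<close>, where \<open>E\<close> carries ones in the two
  corners only. The last summand is non-negative definite since \<open>r \<ge> p - s\<close>, so all that
  matters is the quadratic polynomial \<open>f t = s t\<^sup>2 + q t + (p - 2 s)\<close> at \<open>T\<close>. The spectrum of
  \<open>T\<close> lies in \<open>[-2, 2]\<close>, and the four sets describe polynomials that are non-negative there.

  Eigenvalues can be avoided: on each set \<open>f\<close> is an explicit combination, with non-negative
  coefficients, of squares of linear polynomials and of \<open>2 - t\<close>, \<open>2 + t\<close>, \<open>4 - t\<^sup>2\<close>
  (\<open>quadratic_certificate\<close>). Each of these becomes a sum of squares when \<open>T\<close> is substituted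
  for \<open>t\<close>. With \<open>N\<close>, \<open>A\<close>, \<open>B\<close> for the values of \<open>I\<close>, \<open>T\<close>, \<open>T\<^sup>2\<close> as quadratic forms at a fixed
  vector, these facts are \<open>path_form_bounds\<close> and \<open>path_form_squares\<close>. The decomposition of
  \<open>D\<close> is \<open>penta_quadratic_form\<close>.
\<close>

section \<open>Quadratic polynomials that are non-negative on the spectral interval\<close>

text \<open>
  Suppose \<open>N\<close>, \<open>A\<close>, \<open>B\<close> are the images of \<open>1\<close>, \<open>t\<close>, \<open>t\<^sup>2\<close> under a linear functional which is
  non-negative on squares of linear polynomials and on \<open>2 - t\<close>, \<open>2 + t\<close>, \<open>4 - t\<^sup>2\<close>. Then it is
  non-negative on \<open>f\<close>, because \<open>f\<close> is a combination of these polynomials.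
\<close>

lemma quadratic_certificate:
  fixes p q s N A B :: real
  assumes sq: "\<And>a b. a\<^sup>2 * B + 2 * a * b * A + b\<^sup>2 * N \<ge> 0"
    and up: "A \<le> 2 * N" and lo: "- A \<le> 2 * N" and B4: "B \<le> 4 * N"
    and D: "(p, q, s) \<in> D1 \<union> D2 \<union> D3 \<union> D4"
  shows "s * B + q * A + (p - 2 * s) * N \<ge> 0"
proof -
  have N0: "N \<ge> 0" using up lo by linarith
  consider (concave) "s \<le> 0" "2 * q \<le> p + 2 * s" "- 2 * q \<le> p + 2 * s"
    | (nonpos_discriminant) "0 < s" "s \<le> p / 2" "\<bar>q\<bar> \<le> sqrt (4 * s * (p - 2 * s))"
    | (vertex_left) "0 < s" "s < p / 6" "sqrt (4 * s * (p - 2 * s)) < q" "2 * q \<le> p + 2 * s"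
    | (vertex_right) "0 < s" "s < p / 6" "sqrt (4 * s * (p - 2 * s)) < - q" "- 2 * q \<le> p + 2 * s"
    using D unfolding D1_def D2_def D3_def D4_def by (auto simp: abs_le_iff field_simps)
  then show ?thesis
  proof cases
    case concave
    \<comment> \<open>\<open>f\<close> is \<open>-s (4 - t\<^sup>2)\<close> plus the linear interpolation of \<open>f\<close> between \<open>-2\<close> and \<open>2\<close>.\<close>
    have "s * B + q * A + (p - 2 * s) * N =
      (- s) * (4 * N - B) + (p + 2 * s + 2 * q) / 4 * (2 * N + A)
      + (p + 2 * s - 2 * q) / 4 * (2 * N - A)"
      by (simp add: field_simps)
    moreover have "(- s) * (4 * N - B) \<ge> 0" using concave B4 by (intro mult_nonneg_nonneg) auto
    moreover have "(p + 2 * s + 2 * q) / 4 * (2 * N + A) \<ge> 0"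
      using concave lo by (intro mult_nonneg_nonneg) auto
    moreover have "(p + 2 * s - 2 * q) / 4 * (2 * N - A) \<ge> 0"
      using concave up by (intro mult_nonneg_nonneg) auto
    ultimately show ?thesis by linarith
  next
    case nonpos_discriminant
    have "q\<^sup>2 \<le> (sqrt (4 * s * (p - 2 * s)))\<^sup>2"
      using nonpos_discriminant(3) by (metis abs_ge_zero power2_abs power_mono)
    then have q2: "q\<^sup>2 \<le> 4 * s * (p - 2 * s)" using nonpos_discriminant by simp
    \<comment> \<open>Multiplied by \<open>s > 0\<close>, \<open>f\<close> is a complete square plus a constant \<open>\<ge> 0\<close>.\<close>
    have "s * (s * B + q * A + (p - 2 * s) * N) =
      (s\<^sup>2 * B + 2 * s * (q / 2) * A + (q / 2)\<^sup>2 * N) + (4 * s * (p - 2 * s) - q\<^sup>2) / 4 * N"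
      by (simp add: field_simps power2_eq_square)
    moreover have "(4 * s * (p - 2 * s) - q\<^sup>2) / 4 * N \<ge> 0"
      using q2 N0 by (intro mult_nonneg_nonneg) auto
    ultimately have "s * (s * B + q * A + (p - 2 * s) * N) \<ge> 0"
      using sq[of s "q / 2"] by linarith
    then show ?thesis using nonpos_discriminant(1) by (simp add: zero_le_mult_iff)
  next
    case vertex_left
    \<comment> \<open>Since \<open>p - 2 s > 4 s\<close>, the vertex \<open>-q / (2 s)\<close> lies to the left of \<open>-2\<close>; therefore the
      expansion of \<open>f\<close> in powers of \<open>2 + t\<close> has non-negative coefficients.\<close>
    have "(4 * s)\<^sup>2 \<le> 4 * s * (p - 2 * s)" using vertex_left by (simp add: power2_eq_square)
    then have q4: "4 * s \<le> q" using vertex_left(3) real_le_rsqrt by fastforce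
    have "s * B + q * A + (p - 2 * s) * N =
      s * (B + 4 * A + 4 * N) + (q - 4 * s) * (2 * N + A) + (p + 2 * s - 2 * q) * N"
      by (simp add: algebra_simps)
    moreover have "s * (B + 4 * A + 4 * N) \<ge> 0"
      using sq[of 1 2] vertex_left(1) by (intro mult_nonneg_nonneg) auto
    moreover have "(q - 4 * s) * (2 * N + A) \<ge> 0" using q4 lo by (intro mult_nonneg_nonneg) auto
    moreover have "(p + 2 * s - 2 * q) * N \<ge> 0"
      using vertex_left N0 by (intro mult_nonneg_nonneg) auto
    ultimately show ?thesis by linarith
  next
    case vertex_right
    \<comment> \<open>The reflection \<open>t \<mapsto> -t\<close> of the previous case: expand in powers of \<open>2 - t\<close>.\<close>
    have "(4 * s)\<^sup>2 \<le> 4 * s * (p - 2 * s)" using vertex_right by (simp add: power2_eq_square)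
    then have q4: "4 * s \<le> - q" using vertex_right(3) real_le_rsqrt by fastforce
    have "s * B + q * A + (p - 2 * s) * N =
      s * (B - 4 * A + 4 * N) + (- q - 4 * s) * (2 * N - A) + (p + 2 * s + 2 * q) * N"
      by (simp add: algebra_simps)
    moreover have "s * (B - 4 * A + 4 * N) \<ge> 0"
      using sq[of 1 "-2"] vertex_right(1) by (intro mult_nonneg_nonneg) auto
    moreover have "(- q - 4 * s) * (2 * N - A) \<ge> 0" using q4 up by (intro mult_nonneg_nonneg) auto
    moreover have "(p + 2 * s + 2 * q) * N \<ge> 0"
      using vertex_right N0 by (intro mult_nonneg_nonneg) auto
    ultimately show ?thesis by linarith
  qed
qed

section \<open>The adjacency form of a path and its square\<close>

text \<open>
  The values at \<open>(x 0, \<dots>, x (m + 1))\<close> of the quadratic forms of \<open>I\<close>, \<open>T\<close> and \<open>T\<^sup>2\<close>, in size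
  \<open>m + 2\<close>.
\<close>

definition norm_form :: "nat \<Rightarrow> (nat \<Rightarrow> real) \<Rightarrow> real" where
  "norm_form m x = (\<Sum>i<m + 2. (x i)\<^sup>2)"

definition path_form :: "nat \<Rightarrow> (nat \<Rightarrow> real) \<Rightarrow> real" where
  "path_form m x = 2 * (\<Sum>i<m + 1. x i * x (i + 1))"

definition path_form2 :: "nat \<Rightarrow> (nat \<Rightarrow> real) \<Rightarrow> real" where
  "path_form2 m x =
     2 * norm_form m x + 2 * (\<Sum>i<m. x i * x (i + 2)) - (x 0)\<^sup>2 - (x (m + 1))\<^sup>2"

text \<open>The sums that arise below from expanding squares run over shifted parts of the index range.\<close>

lemma shifted_square_sums:
  fixes x :: "nat \<Rightarrow> real"
  shows "(\<Sum>i<m. (x i)\<^sup>2) = norm_form m x - (x m)\<^sup>2 - (x (m + 1))\<^sup>2"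
    and "(\<Sum>i<m. (x (i + 1))\<^sup>2) = norm_form m x - (x 0)\<^sup>2 - (x (m + 1))\<^sup>2"
    and "(\<Sum>i<m. (x (i + 2))\<^sup>2) = norm_form m x - (x 0)\<^sup>2 - (x 1)\<^sup>2"
    and "(\<Sum>i<m. x i * x (i + 1)) = path_form m x / 2 - x m * x (m + 1)"
    and "(\<Sum>i<m. x (i + 1) * x (i + 2)) = path_form m x / 2 - x 0 * x 1"
proof -
  have N2: "norm_form m x = (x 0)\<^sup>2 + (\<Sum>i<m + 1. (x (i + 1))\<^sup>2)"
    unfolding norm_form_def using sum.lessThan_Suc_shift[of "\<lambda>i. (x i)\<^sup>2" "Suc m"] by simp
  have N3: "(\<Sum>i<m + 1. (x (i + 1))\<^sup>2) = (x 1)\<^sup>2 + (\<Sum>i<m. (x (i + 2))\<^sup>2)"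
    using sum.lessThan_Suc_shift[of "\<lambda>i. (x (i + 1))\<^sup>2" m] by simp
  show "(\<Sum>i<m. (x i)\<^sup>2) = norm_form m x - (x m)\<^sup>2 - (x (m + 1))\<^sup>2"
    by (simp add: norm_form_def)
  show "(\<Sum>i<m. (x (i + 1))\<^sup>2) = norm_form m x - (x 0)\<^sup>2 - (x (m + 1))\<^sup>2"
    using N2 by simp
  show "(\<Sum>i<m. (x (i + 2))\<^sup>2) = norm_form m x - (x 0)\<^sup>2 - (x 1)\<^sup>2"
    using N2 N3 by linarith
  show "(\<Sum>i<m. x i * x (i + 1)) = path_form m x / 2 - x m * x (m + 1)"
    by (simp add: path_form_def field_simps)
  show "(\<Sum>i<m. x (i + 1) * x (i + 2)) = path_form m x / 2 - x 0 * x 1"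
    unfolding path_form_def
    using sum.lessThan_Suc_shift[of "\<lambda>i. x i * x (i + 1)" m] by (simp add: field_simps)
qed

text \<open>
  The left side is the squared norm of \<open>a T x + b x\<close>. The first and the last component of this
  vector have a single neighbour term each, and the others are collected in the sum.
\<close>

lemma path_form_squares:
  fixes x :: "nat \<Rightarrow> real"
  shows "a\<^sup>2 * path_form2 m x + 2 * a * b * path_form m x + b\<^sup>2 * norm_form m x \<ge> 0"
proof -
  have "(\<Sum>i<m. (a * (x i + x (i + 2)) + b * x (i + 1))\<^sup>2) =
    (\<Sum>i<m. a\<^sup>2 * (x i)\<^sup>2 + a\<^sup>2 * (x (i + 2))\<^sup>2 + b\<^sup>2 * (x (i + 1))\<^sup>2
      + 2 * a\<^sup>2 * (x i * x (i + 2)) + 2 * a * b * (x i * x (i + 1))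
      + 2 * a * b * (x (i + 1) * x (i + 2)))"
    by (intro sum.cong refl) (simp add: power2_eq_square algebra_simps)
  also have "\<dots> = a\<^sup>2 * (\<Sum>i<m. (x i)\<^sup>2) + a\<^sup>2 * (\<Sum>i<m. (x (i + 2))\<^sup>2)
      + b\<^sup>2 * (\<Sum>i<m. (x (i + 1))\<^sup>2)
      + 2 * a\<^sup>2 * (\<Sum>i<m. x i * x (i + 2)) + 2 * a * b * (\<Sum>i<m. x i * x (i + 1))
      + 2 * a * b * (\<Sum>i<m. x (i + 1) * x (i + 2))"
    by (simp only: sum.distrib sum_distrib_left)
  finally have "a\<^sup>2 * path_form2 m x + 2 * a * b * path_form m x + b\<^sup>2 * norm_form m x =
    (\<Sum>i<m. (a * (x i + x (i + 2)) + b * x (i + 1))\<^sup>2)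
    + (a * x 1 + b * x 0)\<^sup>2 + (a * x m + b * x (m + 1))\<^sup>2"
    unfolding shifted_square_sums[of x m] path_form2_def
    by (simp add: power2_eq_square algebra_simps)
  also have "\<dots> \<ge> 0" by (intro add_nonneg_nonneg sum_nonneg) auto
  finally show ?thesis .
qed

text \<open>
  That the spectrum of \<open>T\<close> lies in \<open>[-2, 2]\<close>, as inequalities between forms. They follow by
  summing the squares of \<open>x i - x (i + 1)\<close>, \<open>x i + x (i + 1)\<close> and \<open>x i - x (i + 2)\<close>.
\<close>

lemma path_form_bounds:
  fixes x :: "nat \<Rightarrow> real"
  shows "path_form m x \<le> 2 * norm_form m x"
    and "- path_form m x \<le> 2 * norm_form m x"
    and "path_form2 m x \<le> 4 * norm_form m x"
proof -
  have first: "(\<Sum>i<m. (x i + c * x (i + 1))\<^sup>2) =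
      2 * norm_form m x + c * path_form m x
      - (x m)\<^sup>2 - 2 * (x (m + 1))\<^sup>2 - (x 0)\<^sup>2 - 2 * c * (x m * x (m + 1))"
    if c: "c\<^sup>2 = 1" for c :: real
  proof -
    have "(\<Sum>i<m. (x i + c * x (i + 1))\<^sup>2) =
      (\<Sum>i<m. (x i)\<^sup>2 + c\<^sup>2 * (x (i + 1))\<^sup>2 + 2 * c * (x i * x (i + 1)))"
      by (intro sum.cong refl) (simp add: power2_eq_square algebra_simps)
    also have "\<dots> = (\<Sum>i<m. (x i)\<^sup>2) + (\<Sum>i<m. (x (i + 1))\<^sup>2)
        + 2 * c * (\<Sum>i<m. x i * x (i + 1))"
      unfolding c by (simp only: sum.distrib sum_distrib_left mult_1)
    finally show ?thesis unfolding shifted_square_sums[of x m] by (simp add: algebra_simps)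
  qed
  have step: "2 * norm_form m x + c * path_form m x \<ge> 0" if c: "c\<^sup>2 = 1" for c :: real
  proof -
    have "(x m + c * x (m + 1))\<^sup>2 =
        (x m)\<^sup>2 + c\<^sup>2 * (x (m + 1))\<^sup>2 + 2 * c * (x m * x (m + 1))"
      by (simp add: power2_eq_square algebra_simps)
    then have "2 * norm_form m x + c * path_form m x =
      (\<Sum>i<m. (x i + c * x (i + 1))\<^sup>2) + (x m + c * x (m + 1))\<^sup>2 + (x (m + 1))\<^sup>2 + (x 0)\<^sup>2"
      unfolding first[OF c] c by simp
    also have "\<dots> \<ge> 0" by (intro add_nonneg_nonneg sum_nonneg) auto
    finally show ?thesis .
  qed
  show "path_form m x \<le> 2 * norm_form m x" using step[of "-1"] by simp
  show "- path_form m x \<le> 2 * norm_form m x" using step[of 1] by simp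
  have "(\<Sum>i<m. (x i - x (i + 2))\<^sup>2) =
    (\<Sum>i<m. (x i)\<^sup>2 + (x (i + 2))\<^sup>2 - 2 * (x i * x (i + 2)))"
    by (intro sum.cong refl) (simp add: power2_eq_square algebra_simps)
  also have "\<dots> = (\<Sum>i<m. (x i)\<^sup>2) + (\<Sum>i<m. (x (i + 2))\<^sup>2) - 2 * (\<Sum>i<m. x i * x (i + 2))"
    by (simp only: sum.distrib sum_subtractf sum_distrib_left)
  finally have "4 * norm_form m x - path_form2 m x =
    (\<Sum>i<m. (x i - x (i + 2))\<^sup>2) + 2 * (x 0)\<^sup>2 + (x 1)\<^sup>2 + (x m)\<^sup>2 + 2 * (x (m + 1))\<^sup>2"
    unfolding shifted_square_sums[of x m] path_form2_def by simp
  also have "\<dots> \<ge> 0" by (intro add_nonneg_nonneg sum_nonneg) auto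
  finally show "path_form2 m x \<le> 4 * norm_form m x" by simp
qed

section \<open>The quadratic form of the pentadiagonal matrix\<close>

definition penta_band :: "real \<Rightarrow> real \<Rightarrow> real \<Rightarrow> nat \<Rightarrow> nat \<Rightarrow> real" where
  "penta_band p q s i j =
     (if i = j then p else if \<bar>int i - int j\<bar> = 1 then q
      else if \<bar>int i - int j\<bar> = 2 then s else 0)"

lemma penta_band_sym: "penta_band p q s i j = penta_band p q s j i"
  by (auto simp: penta_band_def)

lemma square_sum_Suc:
  fixes g :: "nat \<Rightarrow> nat \<Rightarrow> real"
  shows "(\<Sum>i<Suc n. \<Sum>j<Suc n. g i j) =
    (\<Sum>i<n. \<Sum>j<n. g i j) + (\<Sum>i<n. g i n + g n i) + g n n"
  by (simp add: sum.distrib)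

text \<open>Enlarging the matrix by one row and column adds one entry to each diagonal of the band.\<close>

lemma penta_band_form:
  fixes x :: "nat \<Rightarrow> real"
  shows "(\<Sum>i<m + 2. \<Sum>j<m + 2. penta_band p q s i j * x i * x j) =
    p * (\<Sum>i<m + 2. (x i)\<^sup>2) + 2 * q * (\<Sum>i<m + 1. x i * x (i + 1))
    + 2 * s * (\<Sum>i<m. x i * x (i + 2))"
proof (induction m)
  case 0
  show ?case
    by (simp add: penta_band_def numeral_2_eq_2 power2_eq_square algebra_simps)
next
  case (Suc m)
  let ?g = "\<lambda>i j. penta_band p q s i j * x i * x j"
  have far: "penta_band p q s i (m + 2) = 0" if "i < m" for i
    using that by (auto simp: penta_band_def)
  have "(\<Sum>i<m + 2. ?g i (m + 2) + ?g (m + 2) i) =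
      (\<Sum>i<m + 2. 2 * penta_band p q s i (m + 2) * x i * x (m + 2))"
    by (intro sum.cong refl) (simp only: penta_band_sym[of p q s "m + 2"], simp add: algebra_simps)
  also have "\<dots> = 2 * s * (x m * x (m + 2)) + 2 * q * (x (m + 1) * x (m + 2))"
    using far by (simp add: penta_band_def)
  finally have border: "(\<Sum>i<m + 2. ?g i (m + 2) + ?g (m + 2) i) =
      2 * s * (x m * x (m + 2)) + 2 * q * (x (m + 1) * x (m + 2))" .
  have diag: "?g (m + 2) (m + 2) = p * (x (m + 2))\<^sup>2"
    by (simp add: penta_band_def power2_eq_square)
  have "(\<Sum>i<Suc m + 2. \<Sum>j<Suc m + 2. ?g i j) =
      (\<Sum>i<m + 2. \<Sum>j<m + 2. ?g i j) + (\<Sum>i<m + 2. ?g i (m + 2) + ?g (m + 2) i)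
      + ?g (m + 2) (m + 2)"
    using square_sum_Suc[of ?g "m + 2"] by simp
  then show ?case
    unfolding Suc.IH border diag by (simp add: algebra_simps)
qed

lemma penta_mat_form_sum:
  assumes "x \<in> carrier_vec n"
  shows "x \<bullet> (penta_mat p q r s n *\<^sub>v x) =
    (\<Sum>i<n. \<Sum>j<n. penta_mat p q r s n $$ (i, j) * x $ i * x $ j)"
proof -
  have [simp]: "dim_row (penta_mat p q r s n) = n" "dim_col (penta_mat p q r s n) = n"
    by (simp_all add: penta_mat_def)
  have [simp]: "dim_vec x = n" using assms by simp
  show ?thesis
    by (simp add: scalar_prod_def sum_distrib_left lessThan_atLeast0 mult.assoc mult.left_commute)
qed

text \<open>
  This is \<open>D = s T\<^sup>2 + q T + (p - 2 s) I + (r - (p - s)) E\<close>. The size is \<open>m + 2\<close> because in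
  size one the two corners are the same entry.
\<close>

lemma penta_quadratic_form:
  assumes x: "x \<in> carrier_vec (m + 2)"
  shows "x \<bullet> (penta_mat p q r s (m + 2) *\<^sub>v x) =
    s * path_form2 m (($) x) + q * path_form m (($) x) + (p - 2 * s) * norm_form m (($) x)
    + (r - (p - s)) * ((x $ 0)\<^sup>2 + (x $ (m + 1))\<^sup>2)"
proof -
  let ?c = "\<lambda>i. if i = 0 \<or> i = m + 1 then r - p else 0"
  have row: "(\<Sum>j<m + 2. penta_mat p q r s (m + 2) $$ (i, j) * x $ i * x $ j) =
      (\<Sum>j<m + 2. penta_band p q s i j * x $ i * x $ j) + ?c i * (x $ i)\<^sup>2"
    if i: "i < m + 2" for i
  proof -
    have "(\<Sum>j<m + 2. penta_mat p q r s (m + 2) $$ (i, j) * x $ i * x $ j) =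
      (\<Sum>j<m + 2. penta_band p q s i j * x $ i * x $ j
        + (if j = i then ?c i * (x $ i)\<^sup>2 else 0))"
      using i by (intro sum.cong refl)
        (auto simp: penta_mat_def penta_band_def power2_eq_square algebra_simps)
    then show ?thesis using i by (simp only: sum.distrib) simp
  qed
  have corners: "(\<Sum>i<m + 2. ?c i * (x $ i)\<^sup>2) = (r - p) * ((x $ 0)\<^sup>2 + (x $ (m + 1))\<^sup>2)"
  proof -
    have "(\<Sum>i<m + 2. ?c i * (x $ i)\<^sup>2) = (\<Sum>i\<in>{0, m + 1}. ?c i * (x $ i)\<^sup>2)"
      by (rule sum.mono_neutral_right) auto
    then show ?thesis by (simp add: algebra_simps)
  qed
  have "x \<bullet> (penta_mat p q r s (m + 2) *\<^sub>v x) =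
    (\<Sum>i<m + 2. (\<Sum>j<m + 2. penta_band p q s i j * x $ i * x $ j) + ?c i * (x $ i)\<^sup>2)"
    unfolding penta_mat_form_sum[OF x] by (rule sum.cong[OF refl]) (rule row, simp)
  also have "\<dots> = (\<Sum>i<m + 2. \<Sum>j<m + 2. penta_band p q s i j * x $ i * x $ j)
      + (r - p) * ((x $ 0)\<^sup>2 + (x $ (m + 1))\<^sup>2)"
    by (simp only: sum.distrib corners)
  finally show ?thesis
    unfolding penta_band_form path_form2_def path_form_def norm_form_def
    by (simp only: algebra_simps)
qed

theorem lemma2p1:
  fixes p q r s :: real
  assumes "p \<ge> 0"
    and "r \<ge> p - s"
    and "(p, q, s) \<in> D1 \<union> D2 \<union> D3 \<union> D4"
  shows "\<forall>n :: nat. nonneg_definite (penta_mat p q r s n)"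
proof
  fix n
  let ?M = "penta_mat p q r s n"
  have dims: "dim_row ?M = n" "dim_col ?M = n" by (simp_all add: penta_mat_def)
  have sym: "transpose_mat ?M = ?M"
    by (rule eq_matI) (auto simp: penta_mat_def)
  have "0 \<le> x \<bullet> (?M *\<^sub>v x)" if x: "x \<in> carrier_vec n" for x
  proof -
    consider "n = 0" | "n = 1" | m where "n = m + 2"
      by (metis One_nat_def Suc_1 add.commute add_Suc_shift not0_implies_Suc plus_1_eq_Suc)
    then show ?thesis
    proof cases
      case 1
      then show ?thesis unfolding penta_mat_form_sum[OF x] by simp
    next
      case 2
      have "s \<le> p"
        using assms(1,3) by (auto simp: D1_def D2_def D3_def D4_def)
      then have "r \<ge> 0" using assms(2) by linarith
      then show ?thesis
        unfolding penta_mat_form_sum[OF x] using 2 by (simp add: penta_mat_def mult.assoc)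
    next
      case 3
      have "(r - (p - s)) * ((x $ 0)\<^sup>2 + (x $ (m + 1))\<^sup>2) \<ge> 0"
        using assms(2) by (intro mult_nonneg_nonneg) auto
      moreover have "s * path_form2 m (($) x) + q * path_form m (($) x)
          + (p - 2 * s) * norm_form m (($) x) \<ge> 0"
        by (rule quadratic_certificate[OF path_form_squares path_form_bounds assms(3)])
      ultimately show ?thesis
        using penta_quadratic_form[of x m p q r s] x 3 by simp
    qed
  qed
  then show "nonneg_definite ?M"
    unfolding nonneg_definite_def using dims sym by (simp add: square_mat.simps)
qed

end
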